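(* Let $p$ be a prime, $n\ge1$, $q=p^n$, let $\gamma\in\mathbb{F}_q^*$ have multiplicative order $T$, and $G=\langle\gamma\rangle$. Let $d:G\to\mathbb{F}_q$ be given by $d(\gamma^x)=\gamma^{x^2}$. Let $m$ be an integer with $0\le m\le T$ and $F:\mathbb{F}_q\to\mathbb{F}_q$ a map with $F(\zeta)=d(\zeta)$ for all but at most $m$ elements $\zeta\in G$. Suppose there exist an $\mathbb{F}_p$-linear subspace $U\le \mathbb{F}_q$ of codimension $k$, a linearised polynomial $M\in\mathbb{F}_q[X]$ and constants $a_V\in\mathbb{F}_q$ indexed by the cosets $V$ of $U$, such that $F(\zeta)=M(\zeta)+a_{U+\zeta}$ for all $\zeta\in\mathbb{F}_q$. If $T\equiv 0\pmod 4$, then $p^k\ge N(T)-2m$.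
   Context: A linearised polynomial over $\mathbb{F}_q$ is one of the form $\sum_{j=0}^{n-1}c_jX^{p^j}$, $c_j\in\mathbb{F}_q$. $N(T)$ denotes the number of squares modulo $T$, i.e. the number of residues $a\in\{0,\ldots,T-1\}$ such that $x^2\equiv a\pmod T$ has a solution. The map $d$ is the univariate Diffie–Hellman mapping to base $\gamma$ (well defined since $x^2\bmod T$ depends only on $x\bmod T$). *)

theory Defs
  imports
    "HOL-Computational_Algebra.Polynomial"
    "HOL-Number_Theory.Cong"
    "Berlekamp_Zassenhaus.Finite_Field"
begin

text \<open>
  The field with \<open>p\<close> elements is \<open>'p mod_ring\<close> with \<open>CARD('p) = p\<close>. It acts on a ring \<open>'a\<close> of
  characteristic \<open>p\<close> by multiplication with the integer representative of the residue class. Linear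
  subspaces and dimensions over it are \<open>module.subspace fp_scale\<close> and \<open>vector_space.dim fp_scale\<close>;
  \<open>vector_space_fp_scale\<close> below shows that the locale assumptions hold in a field with \<open>p ^ n\<close>
  elements.
\<close>
definition fp_scale :: "'p::prime_card mod_ring \<Rightarrow> 'a::ring_1 \<Rightarrow> 'a" where
  "fp_scale c x = of_int (to_int_mod_ring c) * x"

lemma CHAR_eq_of_card_eq_prime_power:
  assumes "prime p" and "CARD('a::{field,finite}) = p ^ n"
  shows "CHAR('a) = p"
proof -
  have "CHAR('a) > 0"
    by (rule finite_imp_CHAR_pos) simp
  then have pr: "prime CHAR('a)"
    by (rule prime_CHAR_semidom)
  have "of_nat CARD('a) = (0::'a)"
  proof -
    have "(\<Sum>x\<in>(UNIV::'a set). x) = (\<Sum>x\<in>UNIV. x + 1)"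
      by (rule sum.reindex_bij_witness[of _ "\<lambda>x. x + 1" "\<lambda>x. x - 1"]) auto
    also have "\<dots> = (\<Sum>x\<in>(UNIV::'a set). x) + of_nat CARD('a)"
      by (simp add: sum.distrib)
    finally show ?thesis
      by simp
  qed
  then have "CHAR('a) dvd p ^ n"
    using assms by (simp add: of_nat_eq_0_iff_char_dvd flip: of_nat_power)
  then have "CHAR('a) dvd p"
    using pr prime_dvd_power by blast
  then show ?thesis
    using pr assms(1) primes_dvd_imp_eq by blast
qed

lemma vector_space_fp_scale:
  assumes "CARD('a::{field,finite}) = CARD('p::prime_card) ^ n"
  shows "vector_space (fp_scale :: 'p mod_ring \<Rightarrow> 'a \<Rightarrow> 'a)"
proof -
  have "CHAR('a) = CARD('p)"
    using CHAR_eq_of_card_eq_prime_power[OF prime_card assms] .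
  then have z: "(of_nat CARD('p) :: 'a) = 0"
    by (metis of_nat_CHAR)
  have red: "(of_int (k mod int CARD('p)) :: 'a) = of_int k" for k
  proof -
    have "(of_int k :: 'a) = of_int (int CARD('p) * (k div int CARD('p)) + k mod int CARD('p))"
      by simp
    also have "\<dots> = of_int (k mod int CARD('p))"
      unfolding of_int_add of_int_mult of_int_of_nat_eq z by simp
    finally show ?thesis
      by simp
  qed
  show ?thesis
    by standard
      (simp_all add: fp_scale_def to_int_mod_ring_add to_int_mod_ring_mult red algebra_simps)
qed

definition linearised_poly :: "nat \<Rightarrow> nat \<Rightarrow> 'a::comm_semiring_1 poly \<Rightarrow> bool" where
  "linearised_poly p n M \<longleftrightarrow> (\<exists>c. M = (\<Sum>j<n. monom (c j) (p ^ j)))"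

text \<open>Meaningful only for elements of finite order.\<close>
definition mult_order :: "'a::monoid_mult \<Rightarrow> nat" where
  "mult_order x = (LEAST k. 0 < k \<and> x ^ k = 1)"

definition num_squares :: "nat \<Rightarrow> nat" where
  "num_squares T = card {a \<in> {0..<T}. \<exists>x. [x\<^sup>2 = a] (mod T)}"

text \<open>Cosets of \<open>U\<close> are sets of this form.\<close>
definition add_coset :: "'a::plus set \<Rightarrow> 'a \<Rightarrow> 'a set" where
  "add_coset U z = (\<lambda>u. u + z) ` U"

text \<open>
  The multiplicative group generated by \<open>g\<close>; nonnegative exponents suffice for \<open>g\<close> of finite order.
\<close>
definition cyc_group :: "'a::monoid_mult \<Rightarrow> 'a set" where
  "cyc_group g = range (\<lambda>x::nat. g ^ x)"

text \<open>
  The univariate Diffie--Hellman mapping to base \<open>g\<close>, as a property of maps that are constrained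
  only on \<open>cyc_group g\<close>.
\<close>
definition is_dh_map :: "'a::monoid_mult \<Rightarrow> ('a \<Rightarrow> 'a) \<Rightarrow> bool" where
  "is_dh_map g d \<longleftrightarrow> (\<forall>x::nat. d (g ^ x) = g ^ (x\<^sup>2))"

end

theory Submission
  imports Defs "HOL-Library.FuncSet"
begin

text \<open>
  Since \<open>4\<close> divides \<open>T\<close>, \<open>\<gamma> ^ (T div 2) = - 1\<close> and the map is even on the cyclic group:
  \<open>d (- \<zeta>) = d \<zeta>\<close>. The polynomial \<open>M\<close> is odd, so adding the two values of \<open>F\<close> at \<open>\<zeta>\<close> and
  \<open>- \<zeta>\<close> cancels \<open>M\<close> and shows that \<open>d \<zeta>\<close> is determined by the coset of \<open>\<zeta>\<close>, unless \<open>F\<close> and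
  \<open>d\<close> disagree at \<open>\<zeta>\<close> or \<open>- \<zeta>\<close>. The image of \<open>d\<close> has at least \<open>num_squares T\<close> elements, and
  there are \<open>p ^ k\<close> cosets.
\<close>

text \<open>Coordinates with respect to a basis \<open>B\<close> of \<open>U\<close> identify
  \<open>U\<close> with the functions from \<open>B\<close> to the scalars. This turns dimensions
  into cardinalities, so that the codimension can be used for counting cosets.\<close>

lemma (in vector_space) card_subspace:
  assumes "finite (UNIV :: 'a set)" and "subspace U" and "finite U"
  shows "card U = CARD('a) ^ dim U"
proof -
  obtain B where B: "B \<subseteq> U" "independent B" "U \<subseteq> span B" "card B = dim U"
    using basis_exists by blast
  have fin: "finite B"
    using B(1) assms(3) finite_subset by blast
  have U: "U = span B"
    using B(1,3) assms(2) span_minimal by blast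
  define f where "f c = (\<Sum>b\<in>B. scale (c b) b)" for c
  have "inj_on f (B \<rightarrow>\<^sub>E UNIV)"
  proof (rule inj_onI)
    fix c e assume c: "c \<in> B \<rightarrow>\<^sub>E UNIV" and e: "e \<in> B \<rightarrow>\<^sub>E UNIV" and eq: "f c = f e"
    have z: "(\<Sum>b\<in>B. scale (c b - e b) b) = 0"
      using eq by (simp add: f_def scale_left_diff_distrib sum_subtractf)
    have "c b - e b = 0" if "b \<in> B" for b
      using independentD[OF B(2) fin order_refl z that] .
    then show "c = e"
      using c e by (intro PiE_ext) auto
  qed
  moreover have "f ` (B \<rightarrow>\<^sub>E UNIV) = U"
  proof -
    \<comment> \<open>\<open>span_finite\<close> describes the span with coefficient functions on
      the whole space; only their values on \<open>B\<close> matter, so extensional functions reach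
      the same vectors.\<close>
    have "f c = f (restrict c B)" for c
      by (simp add: f_def)
    moreover have "restrict c B \<in> B \<rightarrow>\<^sub>E UNIV" for c :: "'b \<Rightarrow> 'a"
      by auto
    ultimately have "range f \<subseteq> f ` (B \<rightarrow>\<^sub>E UNIV)"
      by blast
    moreover have "range f = U"
      by (simp add: U span_finite[OF fin] f_def)
    ultimately show ?thesis
      by blast
  qed
  ultimately have "card U = card (B \<rightarrow>\<^sub>E (UNIV :: 'a set))"
    using card_image by blast
  then show ?thesis
    using fin B(4) by (simp add: card_PiE)
qed

text \<open>Lagrange's theorem for the additive group: cosets that meet coincide, and all are
  translates of \<open>U\<close>.\<close>

lemma card_range_add_coset:
  fixes U :: "'a::{ab_group_add,finite} set"
  assumes "0 \<in> U" and add: "\<And>x y. x \<in> U \<Longrightarrow> y \<in> U \<Longrightarrow> x + y \<in> U"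
    and neg: "\<And>x. x \<in> U \<Longrightarrow> - x \<in> U"
  shows "card U * card (range (add_coset U)) = CARD('a)"
proof -
  have mem: "x \<in> add_coset U y \<longleftrightarrow> x - y \<in> U" for x y
    by (force simp: add_coset_def image_iff algebra_simps)
  have disj: "add_coset U x \<inter> add_coset U y = {}" if "add_coset U x \<noteq> add_coset U y" for x y
  proof (rule ccontr)
    assume "add_coset U x \<inter> add_coset U y \<noteq> {}"
    then obtain z where z: "z - x \<in> U" "z - y \<in> U"
      using mem by auto
    have xy: "x - y \<in> U"
      using add[OF z(2) neg[OF z(1)]] by (simp add: algebra_simps)
    have "w - x \<in> U \<longleftrightarrow> w - y \<in> U" for w
      using add[OF _ xy, of "w - x"] add[OF _ neg[OF xy], of "w - y"] by auto
    then have "add_coset U x = add_coset U y"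
      by (simp add: set_eq_iff mem)
    then show False
      using that by contradiction
  qed
  have "card (add_coset U x) = card U" for x
    unfolding add_coset_def by (rule card_image) (simp add: inj_on_def)
  then have "card U * card (range (add_coset U)) = card (\<Union> (range (add_coset U)))"
    using disj by (intro card_partition) auto
  also have "\<Union> (range (add_coset U)) = UNIV"
    using mem assms(1) by (metis UN_I UNIV_I UNIV_eq_I diff_self)
  finally show ?thesis .
qed

context
  fixes g :: "'a::{field,finite}"
  assumes nz: "g \<noteq> 0"
begin

text \<open>In a finite field two powers of \<open>g\<close> collide, and cancelling leaves a
  positive exponent with value 1. Hence the \<open>LEAST\<close> in \<open>mult_order\<close> is
  attained.\<close>

lemma mult_order_pos_power: "0 < mult_order g \<and> g ^ mult_order g = 1"
proof -
  have "\<not> inj (\<lambda>i::nat. g ^ i)"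
    using finite_imageD[of "\<lambda>i::nat. g ^ i" UNIV] by auto
  then obtain i j :: nat where "g ^ i = g ^ j" "i < j"
    unfolding inj_def by (metis linorder_neqE_nat)
  moreover from this have "g ^ j = g ^ i * g ^ (j - i)"
    using power_add[of g i "j - i"] by simp
  ultimately have "0 < j - i \<and> g ^ (j - i) = 1"
    using nz by simp
  then show ?thesis
    unfolding mult_order_def by (rule LeastI)
qed

lemma mult_order_least: "0 < k \<Longrightarrow> g ^ k = 1 \<Longrightarrow> mult_order g \<le> k"
  unfolding mult_order_def by (rule Least_le) simp

lemma power_mod_mult_order: "g ^ (x mod mult_order g) = g ^ x"
proof -
  have "g ^ x = g ^ (mult_order g * (x div mult_order g) + x mod mult_order g)"
    by simp
  also have "\<dots> = g ^ (x mod mult_order g)"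
    unfolding power_add power_mult using mult_order_pos_power by simp
  finally show ?thesis
    by simp
qed

lemma inj_on_power_mult_order: "inj_on (\<lambda>i. g ^ i) {0..<mult_order g}"
proof (rule linorder_inj_onI)
  fix i j assume "i < j" and ij: "i \<in> {0..<mult_order g}" "j \<in> {0..<mult_order g}"
  then have "g ^ j = g ^ i * g ^ (j - i)"
    by (simp flip: power_add)
  moreover have "g ^ (j - i) \<noteq> 1"
    using mult_order_least[of "j - i"] ij \<open>i < j\<close> by fastforce
  ultimately show "g ^ i \<noteq> g ^ j"
    using nz by simp
qed auto

text \<open>Distinct residues below the order give distinct powers of \<open>g\<close>, and for a
  square residue this power is a value of \<open>d\<close>.\<close>

lemma num_squares_le_card_image:
  assumes "is_dh_map g d"
  shows "num_squares (mult_order g) \<le> card (d ` cyc_group g)"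
  unfolding num_squares_def
proof (rule card_inj_on_le)
  show "inj_on (\<lambda>i. g ^ i) {a \<in> {0..<mult_order g}. \<exists>x. [x\<^sup>2 = a] (mod mult_order g)}"
    by (rule inj_on_subset[OF inj_on_power_mult_order]) auto
  have "g ^ a \<in> d ` cyc_group g" if "[x\<^sup>2 = a] (mod mult_order g)" for a x
  proof -
    have "g ^ a = g ^ (x\<^sup>2)"
      using that power_mod_mult_order unfolding cong_def by metis
    also have "\<dots> = d (g ^ x)"
      using assms by (simp add: is_dh_map_def)
    finally show ?thesis
      by (auto simp: cyc_group_def)
  qed
  then show "(\<lambda>i. g ^ i) ` {a \<in> {0..<mult_order g}. \<exists>x. [x\<^sup>2 = a] (mod mult_order g)}
      \<subseteq> d ` cyc_group g"
    by auto
qed simp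

text \<open>The power is a square root of 1 in a field, and minimality of the order excludes 1
  itself.\<close>

lemma power_half_mult_order:
  assumes "even (mult_order g)"
  shows "g ^ (mult_order g div 2) = - 1" and "g ^ (mult_order g div 2) \<noteq> 1"
proof -
  let ?h = "mult_order g div 2"
  have "0 < ?h" "?h < mult_order g"
    using mult_order_pos_power assms by auto
  then show "g ^ ?h \<noteq> 1"
    using mult_order_least[of ?h] by fastforce
  moreover have "(g ^ ?h)\<^sup>2 = 1"
    using mult_order_pos_power assms by (simp flip: power_mult)
  ultimately show "g ^ ?h = - 1"
    by (simp add: power2_eq_1_iff)
qed

text \<open>With order 4t, negation adds 2t to the exponent x, which changes x^2 by 4t(x + t), a
  multiple of the order. For an order 2h with h odd this fails, since h^2 is then not divisible by
  2h.\<close>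

lemma is_dh_map_uminus:
  assumes "is_dh_map g d" and "4 dvd mult_order g" and "z \<in> cyc_group g"
  shows "- z \<in> cyc_group g" and "d (- z) = d z"
proof -
  obtain t where t: "mult_order g = 4 * t"
    using assms(2) by auto
  obtain x where x: "z = g ^ x"
    using assms(3) by (auto simp: cyc_group_def)
  have mz: "- z = g ^ (x + 2 * t)"
    using power_half_mult_order(1) t by (simp add: power_add x)
  then show "- z \<in> cyc_group g"
    by (auto simp: cyc_group_def)
  have "(x + 2 * t)\<^sup>2 = x\<^sup>2 + 4 * t * (x + t)"
    by (simp add: power2_eq_square algebra_simps)
  then have "g ^ ((x + 2 * t)\<^sup>2) = g ^ (x\<^sup>2) * (g ^ (4 * t)) ^ (x + t)"
    by (simp add: power_add power_mult)
  also have "\<dots> = g ^ (x\<^sup>2)"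
    using mult_order_pos_power t by simp
  finally show "d (- z) = d z"
    using assms(1) mz x by (simp add: is_dh_map_def)
qed

end

text \<open>All exponents p^j are odd.\<close>

lemma poly_linearised_uminus:
  fixes M :: "'a::comm_ring_1 poly"
  assumes "odd p" and "linearised_poly p n M"
  shows "poly M (- z) = - poly M z"
proof -
  obtain c where "M = (\<Sum>j<n. monom (c j) (p ^ j))"
    using assms(2) by (auto simp: linearised_poly_def)
  then show ?thesis
    using assms(1) by (simp add: poly_sum poly_monom sum_negf)
qed

theorem theorem3p2:
  fixes p n T m k :: nat
    and \<gamma> :: "'a::{field,finite}"
    and d F :: "'a \<Rightarrow> 'a"
    and U :: "'a set"
    and M :: "'a poly"
    and a :: "'a set \<Rightarrow> 'a"
  defines "scale \<equiv> (fp_scale :: 'p::prime_card mod_ring \<Rightarrow> 'a \<Rightarrow> 'a)"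
  assumes "prime p" and "CARD('p) = p"
    and "n \<ge> 1" and "CARD('a) = p ^ n"
    and "\<gamma> \<noteq> 0" and "mult_order \<gamma> = T"
    and "is_dh_map \<gamma> d"
    and "m \<le> T"
    and "card {\<zeta> \<in> cyc_group \<gamma>. F \<zeta> \<noteq> d \<zeta>} \<le> m"
    and "module.subspace scale U"
    and "vector_space.dim scale U + k = vector_space.dim scale UNIV"
    and "linearised_poly p n M"
    and "\<forall>\<zeta>. F \<zeta> = poly M \<zeta> + a (add_coset U \<zeta>)"
    and "[T = 0] (mod 4)"
  shows "int (p ^ k) \<ge> int (num_squares T) - 2 * int m"
proof -
  interpret V: vector_space scale
    unfolding scale_def using vector_space_fp_scale assms(3,5) by blast
  have sub: "V.subspace U"
    by fact
  have card_sub: "card W = p ^ V.dim W" if "V.subspace W" for W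
    using V.card_subspace[OF _ that] assms(3) by simp
  \<comment> \<open>Comparing this with the coset count and cancelling \<open>card U\<close> gives
    the number of cosets.\<close>
  have "card U * p ^ k = CARD('a)"
    using card_sub[OF sub] card_sub[OF V.subspace_UNIV] assms(12)
    by (simp flip: power_add)
  moreover have "card U * card (range (add_coset U)) = CARD('a)"
    using sub by (intro card_range_add_coset V.subspace_0 V.subspace_add V.subspace_neg)
  ultimately have "card U * card (range (add_coset U)) = card U * p ^ k"
    by simp
  moreover have "card U \<noteq> 0"
    using V.subspace_0[OF sub] by auto
  ultimately have cosets: "card (range (add_coset U)) = p ^ k"
    by simp

  have four: "4 dvd mult_order \<gamma>"
    using assms(7,15) by (simp add: cong_0_iff)
  \<comment> \<open>An even order excludes characteristic 2: half the order gives a power equal to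
    -1 but not to 1. This makes \<open>M\<close> odd and division by 2 legitimate.\<close>
  then have "even (mult_order \<gamma>)"
    by (metis dvd_trans even_numeral)
  then have "(1::'a) \<noteq> - 1"
    using power_half_mult_order[OF assms(6)] by metis
  then have two: "(2::'a) \<noteq> 0"
    by (metis add_eq_0_iff one_add_one)
  have "p \<noteq> 2"
    using CHAR_eq_of_card_eq_prime_power[OF assms(2,5)] two of_nat_CHAR[where 'a = 'a] by auto
  then have "odd p"
    using assms(2) primes_dvd_imp_eq two_is_prime_nat by metis
  note M_odd = poly_linearised_uminus[OF this assms(13)]
  note d_even = is_dh_map_uminus[OF assms(6,8) four]

  define G where "G = cyc_group \<gamma>"
  define B where "B = {\<zeta> \<in> G. F \<zeta> \<noteq> d \<zeta>}"
  \<comment> \<open>If \<open>V\<close> is the coset of z, then \<open>uminus\<close> applied to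
    \<open>V\<close> elementwise is the coset of -z, so \<open>h V\<close> is the mean of the two
    constants met at z and -z.\<close>
  define h where "h V = (a V + a (uminus ` V)) / 2" for V
  have neg_coset: "uminus ` add_coset U z = add_coset U (- z)" for z
  proof -
    have "uminus ` U = U"
      using V.subspace_neg[OF sub] by (force simp: image_iff)
    then have "add_coset U (- z) = (\<lambda>u. u - z) ` uminus ` U"
      by (simp add: add_coset_def)
    then show ?thesis
      by (simp add: add_coset_def image_image)
  qed
  have "d z \<in> h ` range (add_coset U) \<union> d ` B" if z: "z \<in> G" for z
  \<comment> \<open>If only -z is exceptional, d z = d (- z) still lies in the image of
    \<open>B\<close>. So the exceptional values number at most m, although up to 2m points are
    affected.\<close>
  proof (cases "z \<in> B \<or> - z \<in> B")
    case True
    then show ?thesis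
      using d_even(2)[of z] z unfolding G_def by (metis UnI2 imageI)
  next
    case False
    then have plus: "d z = poly M z + a (add_coset U z)"
      and minus: "d z = - poly M z + a (add_coset U (- z))"
      using d_even[of z] z assms(14)[rule_format, of z] assms(14)[rule_format, of "- z"] M_odd[of z]
      unfolding B_def G_def by simp_all
    have "2 * d z = d z + d z"
      by (rule mult_2)
    also have "\<dots> = (poly M z + a (add_coset U z)) + (- poly M z + a (add_coset U (- z)))"
      using plus minus by (rule arg_cong2)
    also have "\<dots> = a (add_coset U z) + a (add_coset U (- z))"
      by (simp add: algebra_simps)
    finally have "d z = h (add_coset U z)"
      using two by (simp add: h_def neg_coset field_simps)
    then show ?thesis
      by blast
  qed
  then have "card (d ` G) \<le> card (h ` range (add_coset U) \<union> d ` B)"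
    by (intro card_mono) auto
  also have "\<dots> \<le> card (h ` range (add_coset U)) + card (d ` B)"
    by (rule card_Un_le)
  also have "\<dots> \<le> p ^ k + m"
    using card_image_le[of "range (add_coset U)" h] card_image_le[of B d] assms(10) cosets
    unfolding B_def G_def by (intro add_mono) (auto intro: le_trans)
  finally have "num_squares T \<le> p ^ k + m"
    using num_squares_le_card_image[OF assms(6,8)] assms(7) by (simp add: G_def)
  then show ?thesis
    by linarith
qed

end
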